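(* Let $(X,\Sigma,\mu)$ be a $\sigma$-finite measure space, let $1\le p\le\infty$ and $1\le q\le\infty$ with $\frac1p+\frac1q=1$. Let $l_A,l_B$ be positive integers, $G_A,G_B\in\Sigma$, and for $1\le i\le l_A$, $1\le j\le l_B$ let $a_i,b_j\in L_p(X,\mu)$, $c_i\in L_q(G_A,\mu)$, $e_j\in L_q(G_B,\mu)$. Let $A,B:L_p(X,\mu)\to L_p(X,\mu)$ be nonzero operators defined by $$(Ax)(t)=\int_{G_A}\sum_{i=1}^{l_A}a_i(t)c_i(s)x(s)\,d\mu_s,\qquad (Bx)(t)=\int_{G_B}\sum_{j=1}^{l_B}b_j(t)e_j(s)x(s)\,d\mu_s$$ for almost every $t$. Let $\delta_0,\delta_1\in\mathbb{R}$, $F(z)=\delta_0+\delta_1z$, and $G=G_A\cap G_B$. Then $AB=\delta_0B+\delta_1BA$ if and only if the following conditions are fulfilled: 1. for almost every $(t,s)\in X\times G$, $$-\sum_{k=1}^{l_B}\delta_0b_k(t)e_k(s)+\sum_{k=1}^{l_B}\sum_{m=1}^{l_A}a_m(t)Q_{G_A}(b_k,c_m)e_k(s)=\sum_{k=1}^{l_B}\sum_{i_1=1}^{l_A}\delta_1b_k(t)Q_{G_B}(e_k,a_{i_1})c_{i_1}(s);$$ 2. for almost every $(t,s)\in X\times(G_A\setminus G)$, $$\sum_{k=1}^{l_B}\sum_{i_1=1}^{l_A}\delta_1b_k(t)Q_{G_B}(e_k,a_{i_1})c_{i_1}(s)=0;$$ 3. for almost every $(t,s)\in X\times(G_B\setminus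 G)$, $$\sum_{k=1}^{l_B}\delta_0b_k(t)e_k(s)=\sum_{k=1}^{l_B}\sum_{m=1}^{l_A}Q_{G_A}(b_k,c_m)a_m(t)e_k(s).$$
   Context: $L_p(X,\mu)$ is the Banach space of (classes modulo null sets of) real-valued measurable functions on $X$ with $\int_X|f|^p\,d\mu<\infty$ ($1\le p<\infty$), or essentially bounded ($p=\infty$). For $G\in\Sigma$, $L_q(G,\mu)$ is the same with $X$ replaced by $G$. The relation $\frac1p+\frac1q=1$ uses $1/\infty=0$. The index in $\mu_s$ indicates the variable of integration. For $\Lambda\in\Sigma$ and functions $u,v$ on $\Lambda$ for which the integral exists and is finite, $Q_\Lambda(u,v)=\int_\Lambda u(t)v(t)\,d\mu$. *)

theory Defs
  imports "HOL-Analysis.Analysis"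
begin

text \<open>
  Exponents are elements of \<^typ>\<open>ennreal\<close>, so that \<^prop>\<open>1 / (\<infinity>::ennreal) = 0\<close>. The set
  \<open>Lp_fun M p\<close> consists of the representatives; values outside \<open>space M\<close> are irrelevant.
  The space over a measurable subset \<open>G\<close> is the one over \<open>restrict_space M G\<close>.
\<close>

definition Lp_fun :: "'a measure \<Rightarrow> ennreal \<Rightarrow> ('a \<Rightarrow> real) set" where
  "Lp_fun M p =
    {f \<in> borel_measurable M.
      if p = \<infinity> then \<exists>C. AE t in M. \<bar>f t\<bar> \<le> C
      else integrable M (\<lambda>t. \<bar>f t\<bar> powr enn2real p)}"

definition Lp_rel :: "'a measure \<Rightarrow> ennreal \<Rightarrow> (('a \<Rightarrow> real) \<times> ('a \<Rightarrow> real)) set" where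
  "Lp_rel M p = {(f, g). f \<in> Lp_fun M p \<and> g \<in> Lp_fun M p \<and> (AE t in M. f t = g t)}"

lemma equiv_Lp_rel: "equiv (Lp_fun M p) (Lp_rel M p)"
proof (rule equivI)
  show "Lp_rel M p \<subseteq> Lp_fun M p \<times> Lp_fun M p"
    by (auto simp: Lp_rel_def)
  show "refl_on (Lp_fun M p) (Lp_rel M p)"
    by (auto simp: Lp_rel_def refl_on_def)
  show "sym (Lp_rel M p)"
    by (auto simp: Lp_rel_def sym_def elim: eventually_mono)
  show "trans (Lp_rel M p)"
    unfolding Lp_rel_def trans_def by (auto elim: eventually_elim2)
qed

definition Lp :: "'a measure \<Rightarrow> ennreal \<Rightarrow> ('a \<Rightarrow> real) set set" where
  "Lp M p = Lp_fun M p // Lp_rel M p"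

definition Lp_class :: "'a measure \<Rightarrow> ennreal \<Rightarrow> ('a \<Rightarrow> real) \<Rightarrow> ('a \<Rightarrow> real) set" where
  "Lp_class M p f = Lp_rel M p `` {f}"

definition Lp_zero :: "'a measure \<Rightarrow> ennreal \<Rightarrow> ('a \<Rightarrow> real) set" where
  "Lp_zero M p = Lp_class M p (\<lambda>_. 0)"

text \<open>On elements of \<open>Lp M p\<close> the unions below range over copies of one and the same class.\<close>

definition Lp_add ::
  "'a measure \<Rightarrow> ennreal \<Rightarrow> ('a \<Rightarrow> real) set \<Rightarrow> ('a \<Rightarrow> real) set \<Rightarrow> ('a \<Rightarrow> real) set" where
  "Lp_add M p \<xi> \<eta> = (\<Union>f\<in>\<xi>. \<Union>g\<in>\<eta>. Lp_class M p (\<lambda>t. f t + g t))"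

definition Lp_scale ::
  "'a measure \<Rightarrow> ennreal \<Rightarrow> real \<Rightarrow> ('a \<Rightarrow> real) set \<Rightarrow> ('a \<Rightarrow> real) set" where
  "Lp_scale M p r \<xi> = (\<Union>f\<in>\<xi>. Lp_class M p (\<lambda>t. r * f t))"

text \<open>
  \<open>T\<close> is the operator on \<open>Lp M p\<close> with separable kernel \<open>\<Sum>i = 1..l. a i t * c i s\<close>
  on \<open>X \<times> G\<close>.
\<close>

definition is_separable_operator ::
  "'a measure \<Rightarrow> ennreal \<Rightarrow> 'a set \<Rightarrow> nat \<Rightarrow> (nat \<Rightarrow> 'a \<Rightarrow> real) \<Rightarrow> (nat \<Rightarrow> 'a \<Rightarrow> real) \<Rightarrow>
    (('a \<Rightarrow> real) set \<Rightarrow> ('a \<Rightarrow> real) set) \<Rightarrow> bool" where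
  "is_separable_operator M p G l a c T \<longleftrightarrow>
    T \<in> Lp M p \<rightarrow> Lp M p \<and>
    (\<forall>\<xi>\<in>Lp M p. \<forall>x\<in>\<xi>. \<forall>y\<in>T \<xi>.
      AE t in M. y t = (LINT s:G|M. (\<Sum>i=1..l. a i t * c i s * x s)))"

definition Q :: "'a measure \<Rightarrow> 'a set \<Rightarrow> ('a \<Rightarrow> real) \<Rightarrow> ('a \<Rightarrow> real) \<Rightarrow> real" where
  "Q M \<Lambda> u v = (LINT t:\<Lambda>|M. u t * v t)"

end

theory Submission
  imports Defs
begin

text \<open>
  Extend the \<open>c\<^sub>i\<close> and \<open>e\<^sub>k\<close> by zero to all of \<open>X\<close>. Then \<open>A\<close> and \<open>B\<close> take a function \<open>x\<close> to the
  finite combinations \<open>\<Sum>\<^sub>i a\<^sub>i \<alpha>\<^sub>i(x)\<close> and \<open>\<Sum>\<^sub>k b\<^sub>k \<beta>\<^sub>k(x)\<close>, where \<open>\<alpha>\<^sub>i(x)\<close> and \<open>\<beta>\<^sub>k(x)\<close> are the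
  integrals of \<open>c\<^sub>i x\<close> and \<open>e\<^sub>k x\<close>. Hence \<open>AB - \<delta>\<^sub>0 B - \<delta>\<^sub>1 BA\<close> again has a kernel of finite rank
  \<open>K(t, s) = \<Sum>\<^sub>j u\<^sub>j(t) v\<^sub>j(s)\<close>: the \<open>v\<^sub>j\<close> are the extended \<open>e\<^sub>k\<close> and \<open>c\<^sub>i\<close>, and the pairings \<open>Q\<close>
  enter the \<open>u\<^sub>j\<close>. On \<open>G\<close>, \<open>G\<^sub>A - G\<close> and \<open>G\<^sub>B - G\<close> the equation \<open>K = 0\<close> becomes the first, second
  and third condition, and outside \<open>G\<^sub>A \<union> G\<^sub>B\<close> the kernel is zero.

  It remains to see that an operator with such a kernel is zero if and only if the kernel vanishes
  almost everywhere (\<open>finite_rank_operator_zero_iff\<close>). If the operator is zero, then for each \<open>x\<close>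
  the integral of \<open>K(t, s) x(s)\<close> over \<open>s\<close> is zero for almost every \<open>t\<close>, with an exceptional null
  set that depends on \<open>x\<close>. As \<open>L\<^sub>p\<close> need not be separable, these null sets cannot be united by
  means of a countable dense set; but the vectors of the integrals of \<open>v\<^sub>j x\<close> lie in a
  finite-dimensional space, and Gaussian elimination yields one null set that serves all \<open>x\<close>
  (\<open>AE_forall_finite_rank\<close>). For \<open>t\<close> outside it, \<open>K(t, \<cdot>)\<close> annihilates \<open>L\<^sub>p\<close>; testing it against its
  own sign on sets of finite measure shows that it is zero almost everywhere
  (\<open>AE_zero_if_annihilates_Lp\<close>). Fubini's theorem translates between iterated and joint null sets.
\<close>

section \<open>Functions in \<open>L\<^sub>p\<close>\<close>

lemma Lp_fun_measurable: "f \<in> Lp_fun M p \<Longrightarrow> f \<in> borel_measurable M"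
  by (simp add: Lp_fun_def)

lemma Lp_fun_scale:
  assumes "f \<in> Lp_fun M p"
  shows "(\<lambda>t. r * f t) \<in> Lp_fun M p"
proof (cases "p = \<infinity>")
  case True
  then obtain C where "AE t in M. \<bar>f t\<bar> \<le> C"
    using assms by (auto simp: Lp_fun_def)
  then have "AE t in M. \<bar>r * f t\<bar> \<le> \<bar>r\<bar> * C"
    by eventually_elim (simp add: abs_mult mult_left_mono)
  then show ?thesis
    using assms True by (auto simp: Lp_fun_def)
next
  case False
  then show ?thesis
    using assms by (auto simp: Lp_fun_def abs_mult powr_mult)
qed

text \<open>
  For finite \<open>p\<close> the bound \<open>\<bar>u + v\<bar> \<le> 2 max \<bar>u\<bar> \<bar>v\<bar>\<close> replaces Minkowski's inequality, as only
  integrability matters.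
\<close>

lemma Lp_fun_add:
  assumes f: "f \<in> Lp_fun M p" and g: "g \<in> Lp_fun M p"
  shows "(\<lambda>t. f t + g t) \<in> Lp_fun M p"
proof (cases "p = \<infinity>")
  case True
  then obtain C D where "AE t in M. \<bar>f t\<bar> \<le> C" "AE t in M. \<bar>g t\<bar> \<le> D"
    using f g by (auto simp: Lp_fun_def)
  then have "AE t in M. \<bar>f t + g t\<bar> \<le> C + D"
    by eventually_elim linarith
  then show ?thesis
    using f g True by (auto simp: Lp_fun_def)
next
  case False
  define r where "r = enn2real p"
  have [measurable]: "f \<in> borel_measurable M" "g \<in> borel_measurable M"
    using f g by (auto simp: Lp_fun_def)
  have r: "r \<ge> 0" by (simp add: r_def)
  have bound: "\<bar>u + v\<bar> powr r \<le> 2 powr r * (\<bar>u\<bar> powr r + \<bar>v\<bar> powr r)" for u v :: real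
  proof -
    have "\<bar>u + v\<bar> powr r \<le> (2 * max \<bar>u\<bar> \<bar>v\<bar>) powr r"
      by (rule powr_mono2) (use r in auto)
    also have "\<dots> = 2 powr r * max \<bar>u\<bar> \<bar>v\<bar> powr r"
      by (rule powr_mult)
    also have "\<dots> \<le> 2 powr r * (\<bar>u\<bar> powr r + \<bar>v\<bar> powr r)"
      by (intro mult_left_mono) (auto simp: max_def)
    finally show ?thesis .
  qed
  have "integrable M (\<lambda>t. \<bar>f t + g t\<bar> powr r)"
  proof (rule Bochner_Integration.integrable_bound)
    show "integrable M (\<lambda>t. 2 powr r * (\<bar>f t\<bar> powr r + \<bar>g t\<bar> powr r))"
      using f g False by (auto simp: Lp_fun_def r_def)
    show "AE t in M. norm (\<bar>f t + g t\<bar> powr r)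
        \<le> norm (2 powr r * (\<bar>f t\<bar> powr r + \<bar>g t\<bar> powr r))"
      using bound by (auto simp: abs_mult)
  qed measurable
  then show ?thesis
    using False by (simp add: Lp_fun_def r_def)
qed

lemma Lp_fun_sum:
  assumes "finite J" "\<And>j. j \<in> J \<Longrightarrow> f j \<in> Lp_fun M p"
  shows "(\<lambda>t. \<Sum>j\<in>J. f j t) \<in> Lp_fun M p"
  using assms
proof (induction J rule: finite_induct)
  case empty
  show ?case by (auto simp: Lp_fun_def)
next
  case (insert j J)
  then show ?case by (simp add: Lp_fun_add)
qed

lemma Lp_fun_linear_combination:
  assumes "finite J" "\<And>j. j \<in> J \<Longrightarrow> f j \<in> Lp_fun M p"
  shows "(\<lambda>t. \<Sum>j\<in>J. f j t * r j) \<in> Lp_fun M p"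
proof (rule Lp_fun_sum)
  fix j assume "j \<in> J"
  then show "(\<lambda>t. f j t * r j) \<in> Lp_fun M p"
    using Lp_fun_scale[OF assms(2), of j "r j"] by (simp add: mult.commute)
qed (rule assms(1))

lemma Lp_fun_extend_by_zero:
  assumes G: "G \<in> sets M" and f: "f \<in> Lp_fun (restrict_space M G) q"
  shows "(\<lambda>s. indicator G s * f s) \<in> Lp_fun M q"
proof -
  have Gs: "G \<inter> space M \<in> sets M" using G by auto
  have meas: "(\<lambda>s. indicator G s * f s) \<in> borel_measurable M"
    using Lp_fun_measurable[OF f] borel_measurable_restrict_space_iff[OF Gs, of f] by simp
  show ?thesis
  proof (cases "q = \<infinity>")
    case True
    then obtain C where "AE s in restrict_space M G. \<bar>f s\<bar> \<le> C"
      using f by (auto simp: Lp_fun_def)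
    then have "AE s in M. s \<in> G \<longrightarrow> \<bar>f s\<bar> \<le> C"
      by (simp add: AE_restrict_space_iff[OF Gs])
    then have "AE s in M. \<bar>indicator G s * f s\<bar> \<le> max 0 C"
      by eventually_elim (auto simp: indicator_def)
    then show ?thesis
      using True meas by (auto simp: Lp_fun_def)
  next
    case False
    have "integrable (restrict_space M G) (\<lambda>s. \<bar>f s\<bar> powr enn2real q)"
      using f False by (auto simp: Lp_fun_def)
    then have "integrable M (\<lambda>s. indicator G s * \<bar>f s\<bar> powr enn2real q)"
      by (simp add: integrable_restrict_space[OF Gs])
    also have "(\<lambda>s. indicator G s * \<bar>f s\<bar> powr enn2real q)
        = (\<lambda>s. \<bar>indicator G s * f s\<bar> powr enn2real q)"
      by (auto simp: indicator_def)
    finally show ?thesis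
      using False meas by (auto simp: Lp_fun_def)
  qed
qed

lemma integrable_mult_ess_bounded:
  fixes f g :: "'a \<Rightarrow> real"
  assumes f: "f \<in> Lp_fun M \<infinity>" and g: "g \<in> Lp_fun M 1"
  shows "integrable M (\<lambda>s. f s * g s)"
proof -
  have [measurable]: "f \<in> borel_measurable M" "g \<in> borel_measurable M"
    using f g by (auto simp: Lp_fun_def)
  obtain C where C: "AE t in M. \<bar>f t\<bar> \<le> C"
    using f by (auto simp: Lp_fun_def)
  have g1: "integrable M (\<lambda>t. \<bar>g t\<bar>)"
    using g by (simp add: Lp_fun_def)
  show ?thesis
  proof (rule Bochner_Integration.integrable_bound)
    show "integrable M (\<lambda>t. C * \<bar>g t\<bar>)"
      using g1 by simp
    show "AE t in M. norm (f t * g t) \<le> norm (C * \<bar>g t\<bar>)"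
      using C
    proof eventually_elim
      case (elim t)
      then have "\<bar>f t\<bar> * \<bar>g t\<bar> \<le> \<bar>C\<bar> * \<bar>g t\<bar>"
        by (intro mult_right_mono) auto
      then show ?case by (simp add: abs_mult)
    qed
  qed measurable
qed

lemma conjugate_exponents_cases:
  fixes p q :: ennreal
  assumes p: "1 \<le> p" and q: "1 \<le> q" and pq: "1 / p + 1 / q = 1"
  obtains "p = \<infinity>" "q = 1" | "p = 1" "q = \<infinity>"
    | "p \<noteq> \<infinity>" "q \<noteq> \<infinity>" "1 < enn2real p" "1 < enn2real q" "1 / enn2real p + 1 / enn2real q = 1"
proof -
  have inv1: "r = 1" if "1 / r = 1" "1 \<le> r" for r :: ennreal
    using that
  proof (cases r)
    case (real x)
    with that have "x \<ge> 1" by simp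
    with that real show ?thesis
      by (simp add: divide_ennreal flip: ennreal_1)
  qed auto
  consider "p = \<infinity>" | "q = \<infinity>" | "p \<noteq> \<infinity>" "q \<noteq> \<infinity>" by blast
  then show ?thesis
  proof cases
    case 1
    then show ?thesis using that(1) pq q inv1 by simp
  next
    case 2
    then show ?thesis using that(2) pq p inv1 by simp
  next
    case 3
    obtain x where x: "p = ennreal x" "0 \<le> x" using 3 by (cases p) auto
    obtain y where y: "q = ennreal y" "0 \<le> y" using 3 by (cases q) auto
    have x1: "x \<ge> 1" and y1: "y \<ge> 1"
      using p q x y by auto
    have "ennreal (1 / x + 1 / y) = ennreal 1"
      using pq x1 y1 unfolding x y
      by (simp add: divide_ennreal ennreal_plus flip: ennreal_1)
    then have xy: "1 / x + 1 / y = 1"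
      using x1 y1 by (subst (asm) ennreal_inj) auto
    have "x \<noteq> 1" "y \<noteq> 1" using xy x1 y1 by auto
    then show ?thesis
      using that(3) 3 x y x1 y1 xy by simp
  qed
qed

text \<open>
  The part of Hoelder's inequality that makes all integrals below exist. For exponents strictly
  between \<open>1\<close> and \<open>\<infinity>\<close> it follows from Young's inequality, applied pointwise.
\<close>

lemma integrable_mult_Lp_fun:
  fixes p q :: ennreal
  assumes "1 \<le> p" "1 \<le> q" "1 / p + 1 / q = 1"
    and f: "f \<in> Lp_fun M q" and g: "g \<in> Lp_fun M p"
  shows "integrable M (\<lambda>s. f s * g s)"
  using assms(1-3)
proof (cases rule: conjugate_exponents_cases)
  case 1
  then show ?thesis
    using integrable_mult_ess_bounded[of g M f] f g by (simp add: mult.commute)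
next
  case 2
  then show ?thesis
    using integrable_mult_ess_bounded[of f M g] f g by simp
next
  case 3
  have [measurable]: "f \<in> borel_measurable M" "g \<in> borel_measurable M"
    using f g by (auto simp: Lp_fun_def)
  show ?thesis
  proof (rule Bochner_Integration.integrable_bound)
    show "integrable M (\<lambda>s. \<bar>f s\<bar> powr enn2real q / enn2real q
        + \<bar>g s\<bar> powr enn2real p / enn2real p)"
      using f g 3 by (auto simp: Lp_fun_def)
    have "\<bar>f s\<bar> * \<bar>g s\<bar> \<le> \<bar>f s\<bar> powr enn2real q / enn2real q
        + \<bar>g s\<bar> powr enn2real p / enn2real p" for s
      by (rule Youngs_inequality) (use 3 in auto)
    then show "AE s in M. norm (f s * g s) \<le> norm (\<bar>f s\<bar> powr enn2real q / enn2real q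
        + \<bar>g s\<bar> powr enn2real p / enn2real p)"
      by (auto simp: abs_mult intro!: AE_I2 order_trans[OF _ abs_ge_self])
  qed measurable
qed

text \<open>These functions lie in every \<open>L\<^sub>p\<close> and serve as test functions.\<close>

lemma bounded_finite_support_Lp_fun:
  assumes x [measurable]: "x \<in> borel_measurable M" and F [measurable]: "F \<in> sets M"
    and fin: "emeasure M F \<noteq> \<infinity>"
    and bd: "\<And>s. \<bar>x s\<bar> \<le> indicator F s"
  shows "x \<in> Lp_fun M p"
proof (cases "p = \<infinity>")
  case True
  have "\<bar>x s\<bar> \<le> 1" for s
    using bd[of s] by (rule order_trans) (simp add: indicator_def)
  then show ?thesis
    using True by (auto simp: Lp_fun_def)
next
  case False
  have "integrable M (\<lambda>s. \<bar>x s\<bar> powr enn2real p)"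
  proof (rule Bochner_Integration.integrable_bound)
    show "integrable M (indicator F :: 'a \<Rightarrow> real)"
      using fin by (simp add: less_top)
    have "\<bar>x s\<bar> powr enn2real p \<le> indicator F s" for s
    proof (cases "s \<in> F")
      case True
      then show ?thesis
        using bd[of s] by (simp add: powr_le1)
    next
      case False
      then show ?thesis using bd[of s] by simp
    qed
    then show "AE s in M. norm (\<bar>x s\<bar> powr enn2real p) \<le> norm (indicator F s :: real)"
      by auto
  qed measurable
  then show ?thesis
    using False by (simp add: Lp_fun_def)
qed

section \<open>Classes modulo null sets\<close>

lemma Lp_class_eq_iff:
  assumes "f \<in> Lp_fun M p" "g \<in> Lp_fun M p"
  shows "Lp_class M p f = Lp_class M p g \<longleftrightarrow> (AE t in M. f t = g t)"
  using eq_equiv_class_iff[OF equiv_Lp_rel assms] assms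
  by (simp add: Lp_class_def Lp_rel_def)

lemma mem_Lp_class_iff:
  assumes "f \<in> Lp_fun M p"
  shows "g \<in> Lp_class M p f \<longleftrightarrow> g \<in> Lp_fun M p \<and> (AE t in M. f t = g t)"
  using assms by (auto simp: Lp_class_def Lp_rel_def)

lemma Lp_class_in_Lp: "f \<in> Lp_fun M p \<Longrightarrow> Lp_class M p f \<in> Lp M p"
  by (simp add: Lp_def Lp_class_def quotientI)

lemma LpE:
  assumes "\<xi> \<in> Lp M p"
  obtains f where "f \<in> Lp_fun M p" "\<xi> = Lp_class M p f"
  using assms by (auto simp: Lp_def Lp_class_def elim: quotientE)

lemma Lp_eq_image: "Lp M p = Lp_class M p ` Lp_fun M p"
  by (auto elim: LpE intro: Lp_class_in_Lp)

lemma Lp_scale_class: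
  assumes f: "f \<in> Lp_fun M p"
  shows "Lp_scale M p r (Lp_class M p f) = Lp_class M p (\<lambda>t. r * f t)"
proof -
  have "Lp_class M p (\<lambda>t. r * g t) = Lp_class M p (\<lambda>t. r * f t)"
    if "g \<in> Lp_class M p f" for g
  proof -
    have g: "g \<in> Lp_fun M p" "AE t in M. f t = g t"
      using that f by (simp_all add: mem_Lp_class_iff)
    have "AE t in M. r * g t = r * f t"
      using g(2) by eventually_elim simp
    then show ?thesis
      using f g by (subst Lp_class_eq_iff) (simp_all add: Lp_fun_scale)
  qed
  moreover have "f \<in> Lp_class M p f"
    using f by (simp add: mem_Lp_class_iff)
  ultimately show ?thesis
    unfolding Lp_scale_def by blast
qed

lemma Lp_add_class:
  assumes f: "f \<in> Lp_fun M p" and g: "g \<in> Lp_fun M p"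
  shows "Lp_add M p (Lp_class M p f) (Lp_class M p g) = Lp_class M p (\<lambda>t. f t + g t)"
proof -
  have "Lp_class M p (\<lambda>t. f' t + g' t) = Lp_class M p (\<lambda>t. f t + g t)"
    if "f' \<in> Lp_class M p f" "g' \<in> Lp_class M p g" for f' g'
  proof -
    have *: "f' \<in> Lp_fun M p" "g' \<in> Lp_fun M p" "AE t in M. f t = f' t" "AE t in M. g t = g' t"
      using that f g by (simp_all add: mem_Lp_class_iff)
    have "AE t in M. f' t + g' t = f t + g t"
      using *(3,4) by eventually_elim simp
    then show ?thesis
      using * f g by (subst Lp_class_eq_iff) (simp_all add: Lp_fun_add)
  qed
  moreover have "f \<in> Lp_class M p f" "g \<in> Lp_class M p g"
    using f g by (simp_all add: mem_Lp_class_iff)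
  ultimately show ?thesis
    unfolding Lp_add_def by blast
qed

text \<open>
  Since each \<open>c\<^sub>i x\<close> is integrable over \<open>G\<close>, the integral of the sum may be split, which gives the
  operator its finite-rank form.
\<close>

lemma separable_operator_class:
  fixes p q :: ennreal
  assumes exps: "1 \<le> p" "1 \<le> q" "1 / p + 1 / q = 1"
    and G: "G \<in> sets M"
    and a: "\<And>i. i \<in> {1..l} \<Longrightarrow> a i \<in> Lp_fun M p"
    and c: "\<And>i. i \<in> {1..l} \<Longrightarrow> c i \<in> Lp_fun (restrict_space M G) q"
    and T: "is_separable_operator M p G l a c T"
    and x: "x \<in> Lp_fun M p"
  shows "T (Lp_class M p x)
    = Lp_class M p (\<lambda>t. \<Sum>i=1..l. a i t * (\<integral>s. indicator G s * c i s * x s \<partial>M))"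
proof -
  define f where "f = (\<lambda>t. \<Sum>i=1..l. a i t * (\<integral>s. indicator G s * c i s * x s \<partial>M))"
  have kernel: "(LINT s:G|M. (\<Sum>i=1..l. a i t * c i s * x s)) = f t" for t
  proof -
    have "integrable M (\<lambda>s. indicator G s * c i s * x s)" if "i \<in> {1..l}" for i
      by (rule integrable_mult_Lp_fun[OF exps Lp_fun_extend_by_zero[OF G c[OF that]] x])
    then have "(\<integral>s. (\<Sum>i=1..l. a i t * (indicator G s * c i s * x s)) \<partial>M) = f t"
      unfolding f_def by (subst Bochner_Integration.integral_sum) auto
    then show ?thesis
      by (simp add: set_lebesgue_integral_def sum_distrib_left mult_ac)
  qed
  have f: "f \<in> Lp_fun M p"
    unfolding f_def using a by (intro Lp_fun_linear_combination) auto
  have \<xi>: "Lp_class M p x \<in> Lp M p"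
    using x by (rule Lp_class_in_Lp)
  then have "T (Lp_class M p x) \<in> Lp M p"
    using T by (auto simp: is_separable_operator_def)
  then obtain y where y: "y \<in> Lp_fun M p" "T (Lp_class M p x) = Lp_class M p y"
    by (rule LpE)
  have "x \<in> Lp_class M p x" "y \<in> T (Lp_class M p x)"
    using x y by (simp_all add: mem_Lp_class_iff)
  moreover have "\<forall>\<xi>\<in>Lp M p. \<forall>x\<in>\<xi>. \<forall>y\<in>T \<xi>.
      AE t in M. y t = (LINT s:G|M. (\<Sum>i=1..l. a i t * c i s * x s))"
    using T by (simp add: is_separable_operator_def)
  ultimately have "AE t in M. y t = (LINT s:G|M. (\<Sum>i=1..l. a i t * c i s * x s))"
    using \<xi> by blast
  then have "AE t in M. y t = f t"
    unfolding kernel .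
  then show ?thesis
    using y f unfolding f_def[symmetric] by (simp add: Lp_class_eq_iff)
qed

section \<open>Vanishing of kernels of finite rank\<close>

text \<open>
  The quantifier over the possibly uncountable set \<open>V\<close> moves inside the almost-everywhere quantifier
  by elimination of one summand at a time. If \<open>L\<^sub>i(z) \<noteq> 0\<close>, the relation for \<open>z\<close> expresses
  \<open>u\<^sub>i\<close> by the other \<open>u\<^sub>j\<close>, at the cost of a single null set. Substituted into the relation for \<open>x\<close>,
  it leaves the same problem with \<open>i\<close> removed and
  \<open>L'\<^sub>j(x) = L\<^sub>j(x) - L\<^sub>j(z) L\<^sub>i(x) / L\<^sub>i(z)\<close>. So at most \<open>card J\<close> members of \<open>V\<close> contribute
  null sets.
\<close>

lemma AE_forall_finite_rank:
  fixes u :: "'j \<Rightarrow> 'a \<Rightarrow> real" and L :: "'j \<Rightarrow> 'x \<Rightarrow> real"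
  assumes "finite J"
    and "\<And>x. x \<in> V \<Longrightarrow> AE t in M. (\<Sum>j\<in>J. u j t * L j x) = 0"
  shows "AE t in M. \<forall>x\<in>V. (\<Sum>j\<in>J. u j t * L j x) = 0"
  using assms
proof (induction "card J" arbitrary: J L)
  case 0
  then show ?case by simp
next
  case (Suc n)
  show ?case
  proof (cases "\<forall>j\<in>J. \<forall>x\<in>V. L j x = 0")
    case True
    then show ?thesis by simp
  next
    case False
    then obtain i z where i: "i \<in> J" and z: "z \<in> V" and nz: "L i z \<noteq> 0"
      by blast
    \<comment> \<open>\<open>L'\<close> vanishes identically at \<open>j = i\<close>, so the summand \<open>i\<close> drops out.\<close>
    define L' where "L' j x = L j x - L j z * L i x / L i z" for j x
    let ?J = "J - {i}"
    have elim_i: "(\<Sum>j\<in>J. u j t * L j x)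
        = (\<Sum>j\<in>?J. u j t * L' j x) + L i x / L i z * (\<Sum>j\<in>J. u j t * L j z)" for t x
    proof -
      have "(\<Sum>j\<in>?J. u j t * L' j x) = (\<Sum>j\<in>J. u j t * L' j x)"
        using Suc.prems(1) i nz by (simp add: sum.remove L'_def)
      also have "\<dots> = (\<Sum>j\<in>J. u j t * L j x) - L i x / L i z * (\<Sum>j\<in>J. u j t * L j z)"
        by (simp add: L'_def sum_distrib_left sum_subtractf algebra_simps)
      finally show ?thesis by simp
    qed
    have "AE t in M. (\<Sum>j\<in>?J. u j t * L' j x) = 0" if "x \<in> V" for x
      using Suc.prems(2)[OF that] Suc.prems(2)[OF z]
    proof eventually_elim
      case (elim t)
      then show ?case using elim_i[of t x] by simp
    qed
    then have "AE t in M. \<forall>x\<in>V. (\<Sum>j\<in>?J. u j t * L' j x) = 0"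
      using Suc.hyps(1)[of ?J L'] Suc.hyps(2) Suc.prems(1) i by simp
    then show ?thesis
      using Suc.prems(2)[OF z] 
    proof eventually_elim
      case (elim t)
      show ?case
      proof
        fix x assume "x \<in> V"
        then show "(\<Sum>j\<in>J. u j t * L j x) = 0"
          using elim elim_i[of t x] by simp
      qed
    qed
  qed
qed

text \<open>
  Against the test function \<open>sgn k\<close>, cut off to a set of finite measure, \<open>k\<close> integrates to the integral
  of \<open>\<bar>k\<bar>\<close> over that set. Countably many such sets cover the space.
\<close>

lemma (in sigma_finite_measure) AE_zero_if_annihilates_Lp:
  fixes k :: "'a \<Rightarrow> real"
  assumes k [measurable]: "k \<in> borel_measurable M"
    and int: "\<And>x. x \<in> Lp_fun M p \<Longrightarrow> integrable M (\<lambda>s. k s * x s)"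
    and zero: "\<And>x. x \<in> Lp_fun M p \<Longrightarrow> (\<integral>s. k s * x s \<partial>M) = 0"
  shows "AE s in M. k s = 0"
proof -
  obtain F :: "nat \<Rightarrow> 'a set" where F: "range F \<subseteq> sets M" "(\<Union>i. F i) = space M"
    "\<And>i. emeasure M (F i) \<noteq> \<infinity>"
    using sigma_finite by metis
  have "AE s in M. s \<in> F n \<longrightarrow> k s = 0" for n
  proof -
    have [measurable]: "F n \<in> sets M" using F by auto
    define x where "x s = sgn (k s) * indicator (F n) s" for s
    have x: "x \<in> Lp_fun M p"
    proof (rule bounded_finite_support_Lp_fun)
      show "x \<in> borel_measurable M" unfolding x_def by measurable
      show "\<bar>x s\<bar> \<le> indicator (F n) s" for s
        by (auto simp: x_def sgn_real_def indicator_def)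
    qed (use F in auto)
    have kx: "k s * x s = \<bar>k s\<bar> * indicator (F n) s" for s
      by (auto simp: x_def abs_if sgn_real_def)
    have "AE s in M. k s * x s = 0"
      using integral_nonneg_eq_0_iff_AE[OF int[OF x]] zero[OF x] by (simp add: kx)
    then show ?thesis
      by eventually_elim (auto simp: kx)
  qed
  then have "AE s in M. \<forall>n. s \<in> F n \<longrightarrow> k s = 0"
    unfolding AE_all_countable by blast
  then show ?thesis
    using AE_space by eventually_elim (use F in auto)
qed

text \<open>
  The interchange of quantifiers reduces the claim to a fixed \<open>t\<close>, where it says that a function of \<open>s\<close>
  annihilates \<open>L\<^sub>p\<close> exactly when it vanishes almost everywhere.
\<close>

lemma (in sigma_finite_measure) finite_rank_operator_zero_iff:
  fixes u v :: "'j \<Rightarrow> 'a \<Rightarrow> real"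
  assumes J: "finite J"
    and v [measurable]: "\<And>j. j \<in> J \<Longrightarrow> v j \<in> borel_measurable M"
    and int: "\<And>j x. j \<in> J \<Longrightarrow> x \<in> Lp_fun M p \<Longrightarrow> integrable M (\<lambda>s. v j s * x s)"
  shows "(\<forall>x\<in>Lp_fun M p. AE t in M. (\<Sum>j\<in>J. u j t * (\<integral>s. v j s * x s \<partial>M)) = 0)
    \<longleftrightarrow> (AE t in M. AE s in M. (\<Sum>j\<in>J. u j t * v j s) = 0)"
proof -
  have kint: "integrable M (\<lambda>s. (\<Sum>j\<in>J. u j t * v j s) * x s)"
    and keq: "(\<integral>s. (\<Sum>j\<in>J. u j t * v j s) * x s \<partial>M)
        = (\<Sum>j\<in>J. u j t * (\<integral>s. v j s * x s \<partial>M))" if x: "x \<in> Lp_fun M p" for t x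
  proof -
    have *: "(\<Sum>j\<in>J. u j t * v j s) * x s = (\<Sum>j\<in>J. u j t * (v j s * x s))" for s
      by (simp add: sum_distrib_right mult.assoc)
    show "integrable M (\<lambda>s. (\<Sum>j\<in>J. u j t * v j s) * x s)"
      unfolding * using int x by (intro Bochner_Integration.integrable_sum) auto
    show "(\<integral>s. (\<Sum>j\<in>J. u j t * v j s) * x s \<partial>M)
        = (\<Sum>j\<in>J. u j t * (\<integral>s. v j s * x s \<partial>M))"
      unfolding * using int x by (subst Bochner_Integration.integral_sum) auto
  qed
  have slice: "(\<forall>x\<in>Lp_fun M p. (\<Sum>j\<in>J. u j t * (\<integral>s. v j s * x s \<partial>M)) = 0)
      \<longleftrightarrow> (AE s in M. (\<Sum>j\<in>J. u j t * v j s) = 0)" (is "?L t \<longleftrightarrow> ?R t") for t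
  proof
    assume "?L t"
    then show "?R t"
      using kint keq by (intro AE_zero_if_annihilates_Lp[where p = p]) auto
  next
    assume R: "?R t"
    have "(\<integral>s. (\<Sum>j\<in>J. u j t * v j s) * x s \<partial>M) = 0" for x
      using R by (intro integral_eq_zero_AE) (auto elim: eventually_mono)
    then show "?L t" by (simp flip: keq[of _ t])
  qed
  have "(\<forall>x\<in>Lp_fun M p. AE t in M. (\<Sum>j\<in>J. u j t * (\<integral>s. v j s * x s \<partial>M)) = 0)
      \<longleftrightarrow> (AE t in M. ?L t)"
    using AE_forall_finite_rank[OF J,
        where V = "Lp_fun M p" and u = u and L = "\<lambda>j x. \<integral>s. v j s * x s \<partial>M"]
    by (auto elim: eventually_mono)
  then show ?thesis
    unfolding slice .
qed

text \<open>
  With iterated null sets over the unrestricted measure, conditions on the parts \<open>G\<close>, \<open>G\<^sub>A - G\<close> and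
  \<open>G\<^sub>B - G\<close> can be joined to a single condition on \<open>X \<times> X\<close>.
\<close>

lemma AE_pair_restrict_iff:
  assumes M: "sigma_finite_measure M" and H: "H \<in> sets M"
    and P: "{z \<in> space (M \<Otimes>\<^sub>M restrict_space M H). P (fst z) (snd z)}
      \<in> sets (M \<Otimes>\<^sub>M restrict_space M H)"
  shows "(AE (t, s) in M \<Otimes>\<^sub>M restrict_space M H. P t s)
    \<longleftrightarrow> (AE t in M. AE s in M. s \<in> H \<longrightarrow> P t s)"
proof -
  have "sigma_finite_measure (restrict_space M H)"
    using M H by (rule sigma_finite_measure_restrict_space)
  then interpret pair_sigma_finite M "restrict_space M H"
    using M by (simp add: pair_sigma_finite_def)
  have "(AE s in restrict_space M H. P t s) \<longleftrightarrow> (AE s in M. s \<in> H \<longrightarrow> P t s)" for t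
    using H by (intro AE_restrict_space_iff) auto
  then show ?thesis
    using AE_pair_iff[OF P] by (simp add: case_prod_unfold)
qed

section \<open>The commutation relation for separable operators\<close>

theorem corollary1:
  fixes M :: "'a measure"
    and p q :: ennreal
    and l\<^sub>A l\<^sub>B :: nat
    and G\<^sub>A G\<^sub>B G :: "'a set"
    and a b c e :: "nat \<Rightarrow> 'a \<Rightarrow> real"
    and A B :: "('a \<Rightarrow> real) set \<Rightarrow> ('a \<Rightarrow> real) set"
    and \<delta>\<^sub>0 \<delta>\<^sub>1 :: real
  assumes "sigma_finite_measure M"
    and "1 \<le> p" and "1 \<le> q" and "1 / p + 1 / q = 1"
    and "1 \<le> l\<^sub>A" and "1 \<le> l\<^sub>B"
    and "G\<^sub>A \<in> sets M" and "G\<^sub>B \<in> sets M"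
    and "\<And>i. i \<in> {1..l\<^sub>A} \<Longrightarrow> a i \<in> Lp_fun M p"
    and "\<And>j. j \<in> {1..l\<^sub>B} \<Longrightarrow> b j \<in> Lp_fun M p"
    and "\<And>i. i \<in> {1..l\<^sub>A} \<Longrightarrow> c i \<in> Lp_fun (restrict_space M G\<^sub>A) q"
    and "\<And>j. j \<in> {1..l\<^sub>B} \<Longrightarrow> e j \<in> Lp_fun (restrict_space M G\<^sub>B) q"
    and "is_separable_operator M p G\<^sub>A l\<^sub>A a c A"
    and "is_separable_operator M p G\<^sub>B l\<^sub>B b e B"
    and "\<exists>\<xi>\<in>Lp M p. A \<xi> \<noteq> Lp_zero M p"
    and "\<exists>\<xi>\<in>Lp M p. B \<xi> \<noteq> Lp_zero M p"
    and "G = G\<^sub>A \<inter> G\<^sub>B"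
  shows "(\<forall>\<xi>\<in>Lp M p. A (B \<xi>) =
            Lp_add M p (Lp_scale M p \<delta>\<^sub>0 (B \<xi>)) (Lp_scale M p \<delta>\<^sub>1 (B (A \<xi>)))) \<longleftrightarrow>
         (AE (t, s) in M \<Otimes>\<^sub>M restrict_space M G.
            - (\<Sum>k=1..l\<^sub>B. \<delta>\<^sub>0 * b k t * e k s)
              + (\<Sum>k=1..l\<^sub>B. \<Sum>m=1..l\<^sub>A. a m t * Q M G\<^sub>A (b k) (c m) * e k s)
            = (\<Sum>k=1..l\<^sub>B. \<Sum>i=1..l\<^sub>A. \<delta>\<^sub>1 * b k t * Q M G\<^sub>B (e k) (a i) * c i s)) \<and>
         (AE (t, s) in M \<Otimes>\<^sub>M restrict_space M (G\<^sub>A - G).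
            (\<Sum>k=1..l\<^sub>B. \<Sum>i=1..l\<^sub>A. \<delta>\<^sub>1 * b k t * Q M G\<^sub>B (e k) (a i) * c i s) = 0) \<and>
         (AE (t, s) in M \<Otimes>\<^sub>M restrict_space M (G\<^sub>B - G).
            (\<Sum>k=1..l\<^sub>B. \<delta>\<^sub>0 * b k t * e k s)
            = (\<Sum>k=1..l\<^sub>B. \<Sum>m=1..l\<^sub>A. Q M G\<^sub>A (b k) (c m) * a m t * e k s))"
proof -
  interpret sigma_finite_measure M by fact
  note exps = assms(2-4)
  note GA = assms(7) and GB = assms(8)
  note a = assms(9) and b = assms(10) and c = assms(11) and e = assms(12)
  note A = separable_operator_class[OF exps GA a c assms(13)]
  note B = separable_operator_class[OF exps GB b e assms(14)]
  define ca where "ca i s = indicator G\<^sub>A s * c i s" for i s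
  define eb where "eb k s = indicator G\<^sub>B s * e k s" for k s
  define \<alpha> where "\<alpha> i x = (\<integral>s. ca i s * x s \<partial>M)" for i x
  define \<beta> where "\<beta> k x = (\<integral>s. eb k s * x s \<partial>M)" for k x
  have ca: "ca i \<in> Lp_fun M q" if "i \<in> {1..l\<^sub>A}" for i
    using Lp_fun_extend_by_zero[OF GA c[OF that]] by (simp add: ca_def[abs_def])
  have eb: "eb k \<in> Lp_fun M q" if "k \<in> {1..l\<^sub>B}" for k
    using Lp_fun_extend_by_zero[OF GB e[OF that]] by (simp add: eb_def[abs_def])
  have A': "A (Lp_class M p x) = Lp_class M p (\<lambda>t. \<Sum>i=1..l\<^sub>A. a i t * \<alpha> i x)"
    if "x \<in> Lp_fun M p" for x
    using A[OF _ _ that] by (simp add: \<alpha>_def ca_def)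
  have B': "B (Lp_class M p x) = Lp_class M p (\<lambda>t. \<Sum>k=1..l\<^sub>B. b k t * \<beta> k x)"
    if "x \<in> Lp_fun M p" for x
    using B[OF _ _ that] by (simp add: \<beta>_def eb_def)
  have \<alpha>_sum: "\<alpha> i (\<lambda>t. \<Sum>k=1..l\<^sub>B. b k t * r k) = (\<Sum>k=1..l\<^sub>B. Q M G\<^sub>A (b k) (c i) * r k)"
    if "i \<in> {1..l\<^sub>A}" for i r
  proof -
    have "integrable M (\<lambda>s. ca i s * b k s)" if "k \<in> {1..l\<^sub>B}" for k
      using integrable_mult_Lp_fun[OF exps ca b] that \<open>i \<in> _\<close> by blast
    then have "(\<integral>s. (\<Sum>k=1..l\<^sub>B. ca i s * b k s * r k) \<partial>M)
        = (\<Sum>k=1..l\<^sub>B. (\<integral>s. ca i s * b k s \<partial>M) * r k)"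
      by (subst Bochner_Integration.integral_sum) auto
    then show ?thesis
      by (simp add: \<alpha>_def Q_def set_lebesgue_integral_def ca_def sum_distrib_left mult_ac)
  qed
  have \<beta>_sum: "\<beta> k (\<lambda>t. \<Sum>i=1..l\<^sub>A. a i t * r i) = (\<Sum>i=1..l\<^sub>A. Q M G\<^sub>B (e k) (a i) * r i)"
    if "k \<in> {1..l\<^sub>B}" for k r
  proof -
    have "integrable M (\<lambda>s. eb k s * a i s)" if "i \<in> {1..l\<^sub>A}" for i
      using integrable_mult_Lp_fun[OF exps eb a] that \<open>k \<in> _\<close> by blast
    then have "(\<integral>s. (\<Sum>i=1..l\<^sub>A. eb k s * a i s * r i) \<partial>M)
        = (\<Sum>i=1..l\<^sub>A. (\<integral>s. eb k s * a i s \<partial>M) * r i)"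
      by (subst Bochner_Integration.integral_sum) auto
    then show ?thesis
      by (simp add: \<beta>_def Q_def set_lebesgue_integral_def eb_def sum_distrib_left mult_ac)
  qed
  \<comment> \<open>The kernel of \<open>AB - \<delta>\<^sub>0 B - \<delta>\<^sub>1 BA\<close> is \<open>\<Sum>j\<in>J. u j t * v j s\<close>. The left summands of \<open>J\<close> carry
    the extended \<open>e\<^sub>k\<close>, from \<open>AB - \<delta>\<^sub>0 B\<close>, and the right ones the extended \<open>c\<^sub>i\<close>, from \<open>- \<delta>\<^sub>1 BA\<close>.\<close>
  define J where "J = {1..l\<^sub>B} <+> {1..l\<^sub>A}"
  define u where "u = case_sum
    (\<lambda>k t. (\<Sum>m=1..l\<^sub>A. a m t * Q M G\<^sub>A (b k) (c m)) - \<delta>\<^sub>0 * b k t)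
    (\<lambda>i t. - (\<Sum>k=1..l\<^sub>B. \<delta>\<^sub>1 * b k t * Q M G\<^sub>B (e k) (a i)))"
  define v where "v = case_sum eb ca"
  have J_sum: "(\<Sum>j\<in>J. u j t * case_sum g h j)
      = (\<Sum>k=1..l\<^sub>B. ((\<Sum>m=1..l\<^sub>A. a m t * Q M G\<^sub>A (b k) (c m)) - \<delta>\<^sub>0 * b k t) * g k)
        - (\<Sum>i=1..l\<^sub>A. (\<Sum>k=1..l\<^sub>B. \<delta>\<^sub>1 * b k t * Q M G\<^sub>B (e k) (a i)) * h i)" for t g h
    by (simp add: J_def u_def sum.Plus sum_negf)
  have relation_iff: "A (B (Lp_class M p x)) = Lp_add M p (Lp_scale M p \<delta>\<^sub>0 (B (Lp_class M p x)))
        (Lp_scale M p \<delta>\<^sub>1 (B (A (Lp_class M p x))))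
      \<longleftrightarrow> (AE t in M. (\<Sum>j\<in>J. u j t * (\<integral>s. v j s * x s \<partial>M)) = 0)"
    if x: "x \<in> Lp_fun M p" for x
  proof -
    have Ax: "(\<lambda>t. \<Sum>i=1..l\<^sub>A. a i t * \<alpha> i x) \<in> Lp_fun M p"
      and Bx: "(\<lambda>t. \<Sum>k=1..l\<^sub>B. b k t * \<beta> k x) \<in> Lp_fun M p"
      by (intro Lp_fun_linear_combination a b; simp)+
    let ?AB = "\<lambda>t. \<Sum>m=1..l\<^sub>A. a m t * (\<Sum>k=1..l\<^sub>B. Q M G\<^sub>A (b k) (c m) * \<beta> k x)"
    let ?BA = "\<lambda>t. \<Sum>k=1..l\<^sub>B. b k t * (\<Sum>i=1..l\<^sub>A. Q M G\<^sub>B (e k) (a i) * \<alpha> i x)"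
    have AB: "A (B (Lp_class M p x)) = Lp_class M p ?AB"
      by (simp only: A' B' x Bx \<alpha>_sum cong: sum.cong)
    have BA: "B (A (Lp_class M p x)) = Lp_class M p ?BA"
      by (simp only: A' B' x Ax \<beta>_sum cong: sum.cong)
    have ABL: "?AB \<in> Lp_fun M p" and BAL: "?BA \<in> Lp_fun M p"
      by (intro Lp_fun_linear_combination a b; simp)+
    have split: "(\<Sum>j\<in>J. u j t * (\<integral>s. v j s * x s \<partial>M))
        = ?AB t - (\<delta>\<^sub>0 * (\<Sum>k=1..l\<^sub>B. b k t * \<beta> k x) + \<delta>\<^sub>1 * ?BA t)" for t
    proof -
      have v_int: "(\<integral>s. v j s * x s \<partial>M) = case_sum (\<lambda>k. \<beta> k x) (\<lambda>i. \<alpha> i x) j" for j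
        by (simp add: v_def \<alpha>_def \<beta>_def split: sum.split)
      have 1: "?AB t = (\<Sum>k=1..l\<^sub>B. (\<Sum>m=1..l\<^sub>A. a m t * Q M G\<^sub>A (b k) (c m)) * \<beta> k x)"
        unfolding sum_distrib_left sum_distrib_right
        by (subst sum.swap) (simp add: mult_ac)
      have 2: "\<delta>\<^sub>1 * ?BA t
          = (\<Sum>i=1..l\<^sub>A. (\<Sum>k=1..l\<^sub>B. \<delta>\<^sub>1 * b k t * Q M G\<^sub>B (e k) (a i)) * \<alpha> i x)"
        unfolding sum_distrib_left sum_distrib_right
        by (subst sum.swap) (simp add: mult_ac)
      show ?thesis
        unfolding v_int J_sum 1 2
        by (simp add: left_diff_distrib sum_subtractf sum_distrib_left mult.assoc)
    qed
    have "Lp_add M p (Lp_scale M p \<delta>\<^sub>0 (B (Lp_class M p x)))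
        (Lp_scale M p \<delta>\<^sub>1 (B (A (Lp_class M p x))))
        = Lp_class M p (\<lambda>t. \<delta>\<^sub>0 * (\<Sum>k=1..l\<^sub>B. b k t * \<beta> k x) + \<delta>\<^sub>1 * ?BA t)"
      unfolding BA B'[OF x] by (simp only: Lp_scale_class Lp_add_class Lp_fun_scale Bx BAL)
    then show ?thesis
      unfolding AB split using ABL BAL Bx
      by (simp add: Lp_class_eq_iff Lp_fun_add Lp_fun_scale)
  qed
  have "(\<forall>\<xi>\<in>Lp M p. A (B \<xi>) =
        Lp_add M p (Lp_scale M p \<delta>\<^sub>0 (B \<xi>)) (Lp_scale M p \<delta>\<^sub>1 (B (A \<xi>))))
      \<longleftrightarrow> (\<forall>x\<in>Lp_fun M p. AE t in M. (\<Sum>j\<in>J. u j t * (\<integral>s. v j s * x s \<partial>M)) = 0)"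
    by (simp only: Lp_eq_image ball_simps relation_iff cong: ball_cong)
  also have "\<dots> \<longleftrightarrow> (AE t in M. AE s in M. (\<Sum>j\<in>J. u j t * v j s) = 0)"
  proof (rule finite_rank_operator_zero_iff)
    show "finite J" by (simp add: J_def)
    have v: "v j \<in> Lp_fun M q" if "j \<in> J" for j
      using that ca eb by (auto simp: J_def v_def)
    show "v j \<in> borel_measurable M" if "j \<in> J" for j
      using v[OF that] by (rule Lp_fun_measurable)
    show "integrable M (\<lambda>s. v j s * x s)" if "j \<in> J" "x \<in> Lp_fun M p" for j x
      using integrable_mult_Lp_fun[OF exps v] that by blast
  qed
  finally have commute_iff: "(\<forall>\<xi>\<in>Lp M p. A (B \<xi>) =
        Lp_add M p (Lp_scale M p \<delta>\<^sub>0 (B \<xi>)) (Lp_scale M p \<delta>\<^sub>1 (B (A \<xi>))))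
      \<longleftrightarrow> (AE t in M. AE s in M. (\<Sum>j\<in>J. u j t * v j s) = 0)" .

  define D where "D t s = (\<Sum>k=1..l\<^sub>B. \<delta>\<^sub>0 * b k t * e k s)" for t s
  define K\<^sub>A\<^sub>B where
    "K\<^sub>A\<^sub>B t s = (\<Sum>k=1..l\<^sub>B. \<Sum>m=1..l\<^sub>A. a m t * Q M G\<^sub>A (b k) (c m) * e k s)" for t s
  define K\<^sub>B\<^sub>A where
    "K\<^sub>B\<^sub>A t s = (\<Sum>k=1..l\<^sub>B. \<Sum>i=1..l\<^sub>A. \<delta>\<^sub>1 * b k t * Q M G\<^sub>B (e k) (a i) * c i s)" for t s
  have kernel: "(\<Sum>j\<in>J. u j t * v j s)
      = indicator G\<^sub>B s * (K\<^sub>A\<^sub>B t s - D t s) - indicator G\<^sub>A s * K\<^sub>B\<^sub>A t s" for t s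
  proof -
    have v_cases: "v j s = case_sum (\<lambda>k. eb k s) (\<lambda>i. ca i s) j" for j
      by (simp add: v_def split: sum.split)
    have 1: "(\<Sum>i=1..l\<^sub>A. (\<Sum>k=1..l\<^sub>B. \<delta>\<^sub>1 * b k t * Q M G\<^sub>B (e k) (a i)) * ca i s)
        = indicator G\<^sub>A s * K\<^sub>B\<^sub>A t s"
      unfolding K\<^sub>B\<^sub>A_def sum_distrib_left sum_distrib_right
      by (subst sum.swap) (simp add: ca_def mult_ac)
    have 2: "(\<Sum>k=1..l\<^sub>B. ((\<Sum>m=1..l\<^sub>A. a m t * Q M G\<^sub>A (b k) (c m)) - \<delta>\<^sub>0 * b k t) * eb k s)
        = indicator G\<^sub>B s * (K\<^sub>A\<^sub>B t s - D t s)"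
      by (simp add: K\<^sub>A\<^sub>B_def D_def eb_def left_diff_distrib right_diff_distrib sum_subtractf
          sum_distrib_left sum_distrib_right mult_ac)
    show ?thesis
      unfolding v_cases J_sum 1 2 ..
  qed
  have regions: "(\<Sum>j\<in>J. u j t * v j s) = 0 \<longleftrightarrow>
      (s \<in> G \<longrightarrow> - D t s + K\<^sub>A\<^sub>B t s = K\<^sub>B\<^sub>A t s) \<and>
      (s \<in> G\<^sub>A - G \<longrightarrow> K\<^sub>B\<^sub>A t s = 0) \<and>
      (s \<in> G\<^sub>B - G \<longrightarrow> D t s = K\<^sub>A\<^sub>B t s)" for t s
    unfolding kernel using assms(17) by (auto simp: indicator_def)

  \<comment> \<open>The three conditions are measurable in \<open>(t, s)\<close>, since each part of the domain lies in the sets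
    on which the \<open>c\<^sub>i\<close> or \<open>e\<^sub>k\<close> that occur there are measurable.\<close>
  have fst_meas: "(\<lambda>z. f (fst z)) \<in> borel_measurable (M \<Otimes>\<^sub>M N)"
    if "f \<in> Lp_fun M p" for f and N :: "'a measure"
    using Lp_fun_measurable[OF that] by measurable
  have snd_meas: "(\<lambda>z. f (snd z)) \<in> borel_measurable (M \<Otimes>\<^sub>M restrict_space M H)"
    if "f \<in> Lp_fun (restrict_space M S) q" "H \<subseteq> S" for f and H S :: "'a set"
    using measurable_restrict_mono[OF Lp_fun_measurable[OF that(1)] that(2)] by measurable
  have D_meas: "(\<lambda>z. D (fst z) (snd z)) \<in> borel_measurable (M \<Otimes>\<^sub>M restrict_space M H)"
    and AB_meas: "(\<lambda>z. K\<^sub>A\<^sub>B (fst z) (snd z)) \<in> borel_measurable (M \<Otimes>\<^sub>M restrict_space M H)"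
    if "H \<subseteq> G\<^sub>B" for H
    unfolding D_def K\<^sub>A\<^sub>B_def
    by (intro borel_measurable_sum borel_measurable_times borel_measurable_const
          fst_meas a b snd_meas[OF e that]; assumption)+
  have BA_meas: "(\<lambda>z. K\<^sub>B\<^sub>A (fst z) (snd z)) \<in> borel_measurable (M \<Otimes>\<^sub>M restrict_space M H)"
    if "H \<subseteq> G\<^sub>A" for H
    unfolding K\<^sub>B\<^sub>A_def
    by (intro borel_measurable_sum borel_measurable_times borel_measurable_const
          fst_meas b snd_meas[OF c that]; assumption)
  have "G \<subseteq> G\<^sub>A" "G \<subseteq> G\<^sub>B" and G: "G \<in> sets M"
    using assms(17) GA GB by auto
  note pair_iff = AE_pair_restrict_iff[OF assms(1)]
  have cond1: "(AE (t, s) in M \<Otimes>\<^sub>M restrict_space M G. - D t s + K\<^sub>A\<^sub>B t s = K\<^sub>B\<^sub>A t s)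
      \<longleftrightarrow> (AE t in M. AE s in M. s \<in> G \<longrightarrow> - D t s + K\<^sub>A\<^sub>B t s = K\<^sub>B\<^sub>A t s)"
    using D_meas[OF \<open>G \<subseteq> G\<^sub>B\<close>] AB_meas[OF \<open>G \<subseteq> G\<^sub>B\<close>] BA_meas[OF \<open>G \<subseteq> G\<^sub>A\<close>]
    by (intro pair_iff G) measurable
  have cond2: "(AE (t, s) in M \<Otimes>\<^sub>M restrict_space M (G\<^sub>A - G). K\<^sub>B\<^sub>A t s = 0)
      \<longleftrightarrow> (AE t in M. AE s in M. s \<in> G\<^sub>A - G \<longrightarrow> K\<^sub>B\<^sub>A t s = 0)"
    using BA_meas[OF Diff_subset] by (intro pair_iff sets.Diff GA G) measurable
  have cond3: "(AE (t, s) in M \<Otimes>\<^sub>M restrict_space M (G\<^sub>B - G). D t s = K\<^sub>A\<^sub>B t s)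
      \<longleftrightarrow> (AE t in M. AE s in M. s \<in> G\<^sub>B - G \<longrightarrow> D t s = K\<^sub>A\<^sub>B t s)"
    using D_meas[OF Diff_subset] AB_meas[OF Diff_subset]
    by (intro pair_iff sets.Diff GB G) measurable
  have K\<^sub>A\<^sub>B_alt: "(\<Sum>k=1..l\<^sub>B. \<Sum>m=1..l\<^sub>A. Q M G\<^sub>A (b k) (c m) * a m t * e k s) = K\<^sub>A\<^sub>B t s" for t s
    by (simp add: K\<^sub>A\<^sub>B_def mult_ac)
  show ?thesis
    unfolding commute_iff regions K\<^sub>A\<^sub>B_alt
    unfolding D_def[symmetric] K\<^sub>A\<^sub>B_def[symmetric] K\<^sub>B\<^sub>A_def[symmetric] cond1 cond2 cond3
    by (simp only: AE_conj_iff)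
qed

end
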